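(* Let $(K,\rho)$ be a nonempty compact metric space and let $X=C^0(K\to K)$ be the space of all continuous maps $K\to K$ with the uniform metric $\mathrm{dist}_X$. Then there exists a residual subset $Y\subset X$ such that every $T\in Y$ is a continuity point of the map $\mathcal{M}:X\to Z$, $T\mapsto \mathcal{M}(K,T)$, where $\mathcal{M}(K,T)$ is the set of all $T$-invariant Borel probability measures on $K$ and $Z$ is the set of all nonempty compact subsets of the space $\mathcal{M}(K)$ of Borel probability measures on $K$, endowed with the Hausdorff metric $d_H$.
   Context: The uniform metric is $\mathrm{dist}_X(S,T)=\sup_{x\in K}\rho(S(x),T(x))$. $\mathcal{M}(K)$ is the set of all Borel probability measures on $K$ with the weak-$*$ topology, metrized by the Kantorovich–Rubinstein distance $W_1(\mu,\nu)=\sup\left(\int_K f\,d\mu-\int_K f\,d\nu\right)$, the supremum being over all $1$-Lipschitz functions $f:K\to\mathbb{R}$; $\mathcal{M}(K)$ is compact. For a nonempty compact $P\subset\mathcal{M}(K)$ and $q\in\mathcal{M}(K)$, $W_1(q,P)=W_1(P,q)$ denotes the distance from $q$ to $P$. For nonempty compact $P,Q\subset\mathcal{M}(K)$, $d_H(P,Q)=\max_{p\in P}W_1(p,Q)+\max_{q\in Q}W_1(q,P)$. The set $\mathcal{M}(K,T)$ is nonempty (Krylov–Bogolyubov) and compact. A subset of $X$ is residual if it is a countable intersection of open dense subsets of $X$. *)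

theory Defs
  imports
    "HOL-Probability.Probability"
    "HOL-Analysis.Bounded_Continuous_Function"
    "HOL-Analysis.Abstract_Metric_Spaces"
begin

text \<open>
  The compact metric space \<open>K\<close> is a type \<open>'k\<close> of class \<open>metric_space\<close> with
  \<open>compact (UNIV :: 'k set)\<close>. Then \<open>C\<^sup>0(K \<rightarrow> K)\<close> is the library type
  \<open>'k \<Rightarrow>\<^sub>C 'k\<close>, since boundedness is automatic and \<open>dist\<close> on that type is the
  uniform metric.
\<close>

definition residual :: "'a::topological_space set \<Rightarrow> bool" where
  "residual Y \<longleftrightarrow>
     (\<exists>G :: nat \<Rightarrow> 'a set. (\<forall>n. open (G n) \<and> closure (G n) = UNIV) \<and> Y = (\<Inter>n. G n))"

definition borel_probs :: "'k::metric_space measure set" where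
  "borel_probs = {\<mu>. sets \<mu> = sets borel \<and> prob_space \<mu>}"

text \<open>
  Since \<open>Metric_space\<close> asks for a distance that is nonnegative and symmetric on the whole
  type, distance functions are given the junk value \<open>0\<close> outside their carrier.
\<close>

definition W1 :: "'k::metric_space measure \<Rightarrow> 'k measure \<Rightarrow> real" where
  "W1 \<mu> \<nu> =
     (if \<mu> \<in> borel_probs \<and> \<nu> \<in> borel_probs
      then SUP f \<in> {f :: 'k \<Rightarrow> real. 1-lipschitz_on UNIV f}. (\<integral>x. f x \<partial>\<mu>) - (\<integral>x. f x \<partial>\<nu>)
      else 0)"

context Metric_space
begin

definition compacts :: "'a set set" where
  "compacts = {P. P \<noteq> {} \<and> compactin mtopology P}"

definition dist_to_set :: "'a \<Rightarrow> 'a set \<Rightarrow> real" where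
  "dist_to_set x P = (INF p\<in>P. d x p)"

text \<open>The sum of the two one-sided excesses, rather than the more usual maximum.\<close>

definition dH :: "'a set \<Rightarrow> 'a set \<Rightarrow> real" where
  "dH P Q =
     (if P \<in> compacts \<and> Q \<in> compacts
      then (SUP p\<in>P. dist_to_set p Q) + (SUP q\<in>Q. dist_to_set q P)
      else 0)"

end

definition compact_measure_sets :: "'k::metric_space measure set set" where
  "compact_measure_sets = Metric_space.compacts borel_probs W1"

definition hausdorff_W1 :: "'k::metric_space measure set \<Rightarrow> 'k measure set \<Rightarrow> real" where
  "hausdorff_W1 = Metric_space.dH borel_probs W1"

definition invariant_measures :: "('k::metric_space \<Rightarrow> 'k) \<Rightarrow> 'k measure set" where
  "invariant_measures T =
     {\<mu> \<in> borel_probs. \<forall>A \<in> sets borel. emeasure \<mu> (T -` A) = emeasure \<mu> A}"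

text \<open>\<open>W1\<close> and \<open>hausdorff_W1\<close> are genuine metrics, so their metric topologies make sense.\<close>

lemma borel_probs_D:
  assumes "\<mu> \<in> borel_probs"
  shows "prob_space \<mu>" "sets \<mu> = sets borel" "space \<mu> = UNIV"
  using assms sets_eq_imp_space_eq[of \<mu> borel] by (auto simp: borel_probs_def)

lemma integrable_lipschitz:
  fixes f :: "'k::metric_space \<Rightarrow> real"
  assumes "compact (UNIV :: 'k set)" "\<mu> \<in> borel_probs" "L-lipschitz_on UNIV f"
  shows "integrable \<mu> f"
proof -
  interpret prob_space \<mu> using borel_probs_D[OF assms(2)] by simp
  have c: "continuous_on UNIV f"
    using assms(3) lipschitz_on_continuous_on by blast
  have m: "f \<in> borel_measurable \<mu>"
    using borel_measurable_continuous_onI[OF c] borel_probs_D(2)[OF assms(2)]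
    by (simp cong: measurable_cong_sets)
  have "bounded (range f)"
    using compact_continuous_image[OF c assms(1)] compact_imp_bounded by blast
  then obtain B where "\<And>x. \<bar>f x\<bar> \<le> B"
    by (auto simp: bounded_iff)
  with m show ?thesis
    by (intro integrable_const_bound[of _ B]) auto
qed

lemma W1_bdd:
  fixes \<mu> \<nu> :: "'k::metric_space measure"
  assumes K: "compact (UNIV :: 'k set)" and m: "\<mu> \<in> borel_probs" and n: "\<nu> \<in> borel_probs"
  shows "bdd_above ((\<lambda>f. (\<integral>x. f x \<partial>\<mu>) - (\<integral>x. f x \<partial>\<nu>)) ` {f :: 'k \<Rightarrow> real. 1-lipschitz_on UNIV f})"
proof -
  interpret m: prob_space \<mu> using borel_probs_D[OF m] by simp
  interpret n: prob_space \<nu> using borel_probs_D[OF n] by simp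
  obtain a :: 'k and B where B: "\<And>x. dist a x \<le> B"
    using compact_imp_bounded[OF K] unfolding bounded_def by auto
  show ?thesis
  proof (rule bdd_aboveI2)
    fix f :: "'k \<Rightarrow> real" assume "f \<in> {f. 1-lipschitz_on UNIV f}"
    then have f: "1-lipschitz_on UNIV f" by simp
    have b: "\<bar>f a - f x\<bar> \<le> B" for x
      using lipschitz_onD[OF f, of a x] B[of x] by (simp add: dist_real_def)
    have "(\<integral>x. f x \<partial>\<mu>) \<le> (\<integral>x. f a + B \<partial>\<mu>)"
      by (rule integral_mono)
        (use b integrable_lipschitz[OF K m f] in \<open>auto simp: abs_le_iff algebra_simps\<close>)
    moreover have "(\<integral>x. f a - B \<partial>\<nu>) \<le> (\<integral>x. f x \<partial>\<nu>)"
      by (rule integral_mono)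
        (use b integrable_lipschitz[OF K n f] in \<open>auto simp: abs_le_iff algebra_simps\<close>)
    ultimately show "(\<integral>x. f x \<partial>\<mu>) - (\<integral>x. f x \<partial>\<nu>) \<le> 2 * B"
      by (simp add: m.prob_space n.prob_space)
  qed
qed

lemma W1_upper:
  fixes \<mu> \<nu> :: "'k::metric_space measure"
  assumes "compact (UNIV :: 'k set)" "\<mu> \<in> borel_probs" "\<nu> \<in> borel_probs"
    and "1-lipschitz_on UNIV f"
  shows "(\<integral>x. f x \<partial>\<mu>) - (\<integral>x. f x \<partial>\<nu>) \<le> W1 \<mu> \<nu>"
  using assms cSUP_upper[OF _ W1_bdd[OF assms(1-3)], of f] by (simp add: W1_def)

lemma W1_least:
  fixes \<mu> \<nu> :: "'k::metric_space measure"
  assumes "\<mu> \<in> borel_probs" "\<nu> \<in> borel_probs"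
    and "\<And>f. 1-lipschitz_on UNIV f \<Longrightarrow> (\<integral>x. f x \<partial>\<mu>) - (\<integral>x. f x \<partial>\<nu>) \<le> B"
  shows "W1 \<mu> \<nu> \<le> B"
proof -
  have "{f :: 'k \<Rightarrow> real. 1-lipschitz_on UNIV f} \<noteq> {}"
    using lipschitz_on_constant[of UNIV "0::real"] lipschitz_on_le[of 0 UNIV _ 1]
    by (metis (mono_tags, lifting) empty_iff mem_Collect_eq zero_le_one)
  with assms show ?thesis
    by (auto simp: W1_def intro!: cSUP_least)
qed

lemma measure_closed_lim:
  fixes C :: "'k::metric_space set"
  assumes m: "\<mu> \<in> borel_probs" and C: "closed C" "C \<noteq> {}"
  shows "(\<lambda>n. \<integral>x. max 0 (1 - real n * infdist x C) \<partial>\<mu>) \<longlonglongrightarrow> measure \<mu> C"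
proof -
  interpret prob_space \<mu> using borel_probs_D[OF m] by simp
  have sb: "sets \<mu> = sets borel" by (rule borel_probs_D[OF m])
  have meas: "(\<lambda>x. max 0 (1 - real n * infdist x C)) \<in> borel_measurable \<mu>" for n
    using sb by (subst measurable_cong_sets[OF sb refl])
      (intro borel_measurable_continuous_onI continuous_intros)
  have CB: "C \<in> sets \<mu>" using C sb by auto
  have lim: "(\<lambda>n. max 0 (1 - real n * infdist x C)) \<longlonglongrightarrow> indicator C x" for x
  proof (cases "x \<in> C")
    case True
    then show ?thesis by simp
  next
    case False
    then have pos: "infdist x C > 0"
      using C in_closed_iff_infdist_zero[OF C, of x] infdist_nonneg[of x C] by linarith
    obtain N where N: "real N * infdist x C > 1"
      using reals_Archimedean3[OF pos] by blast
    have "max 0 (1 - real n * infdist x C) = 0" if "n \<ge> N" for n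
    proof -
      have "real N * infdist x C \<le> real n * infdist x C"
        using that pos by (intro mult_right_mono) auto
      with N show ?thesis by simp
    qed
    then have "\<forall>\<^sub>F n in sequentially. max 0 (1 - real n * infdist x C) = 0"
      by (auto simp: eventually_sequentially)
    with False show ?thesis by (simp add: tendsto_eventually)
  qed
  have "(\<lambda>n. \<integral>x. max 0 (1 - real n * infdist x C) \<partial>\<mu>) \<longlonglongrightarrow> (\<integral>x. indicator C x \<partial>\<mu>)"
    by (rule integral_dominated_convergence[where w = "\<lambda>_. 1"])
      (use CB meas lim in \<open>auto simp: infdist_nonneg\<close>)
  with CB sets.sets_into_space[OF CB] show ?thesis
    by (simp add: Int_absorb2)
qed

lemma W1_eq_0D:
  fixes \<mu> \<nu> :: "'k::metric_space measure"
  assumes K: "compact (UNIV :: 'k set)" and m: "\<mu> \<in> borel_probs" and n: "\<nu> \<in> borel_probs"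
    and le: "W1 \<mu> \<nu> \<le> 0" "W1 \<nu> \<mu> \<le> 0"
  shows "\<mu> = \<nu>"
proof -
  interpret m: prob_space \<mu> using borel_probs_D[OF m] by simp
  interpret n: prob_space \<nu> using borel_probs_D[OF n] by simp
  have eq1: "(\<integral>x. f x \<partial>\<mu>) = (\<integral>x. f x \<partial>\<nu>)" if "1-lipschitz_on UNIV f" for f :: "'k \<Rightarrow> real"
    using W1_upper[OF K m n that] W1_upper[OF K n m that] le by linarith
  have eq: "(\<integral>x. max 0 (1 - real k * infdist x C) \<partial>\<mu>) = (\<integral>x. max 0 (1 - real k * infdist x C) \<partial>\<nu>)"
    for C :: "'k set" and k
  proof -
    define L where "L = real k + 1"
    have L: "L > 0" by (simp add: L_def)
    let ?f = "\<lambda>x. max 0 (1 - real k * infdist x C)"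
    have "1-lipschitz_on UNIV (\<lambda>x. ?f x / L)"
    proof (rule lipschitz_onI)
      fix x y :: 'k
      have "\<bar>infdist x C - infdist y C\<bar> \<le> dist x y"
        by (rule infdist_triangle_abs)
      then have "real k * \<bar>infdist x C - infdist y C\<bar> \<le> real k * dist x y"
        by (intro mult_left_mono) auto
      then have "\<bar>real k * infdist x C - real k * infdist y C\<bar> \<le> real k * dist x y"
        by (simp add: abs_mult flip: right_diff_distrib)
      then have "\<bar>?f x - ?f y\<bar> \<le> real k * dist x y" by linarith
      also have "\<dots> \<le> L * dist x y" by (intro mult_right_mono) (auto simp: L_def)
      finally show "dist (?f x / L) (?f y / L) \<le> 1 * dist x y"
        using L by (simp add: dist_real_def field_simps flip: diff_divide_distrib)
    qed simp
    from eq1[OF this] L show ?thesis by simp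
  qed
  have cl: "emeasure \<mu> C = emeasure \<nu> C" if "closed C" for C
  proof (cases "C = {}")
    case False
    have "measure \<mu> C = measure \<nu> C"
      using LIMSEQ_unique[OF measure_closed_lim[OF m that False]]
        measure_closed_lim[OF n that False] eq by simp
    then show ?thesis by (simp add: m.emeasure_eq_measure n.emeasure_eq_measure)
  qed simp
  show ?thesis
  proof (rule measure_eqI_generator_eq[where E = "Collect closed" and \<Omega> = UNIV and A = "\<lambda>_. UNIV"])
    show "Int_stable (Collect closed :: 'k set set)" by (auto simp: Int_stable_def)
    show "sets \<mu> = sigma_sets UNIV (Collect closed)" "sets \<nu> = sigma_sets UNIV (Collect closed)"
      using borel_probs_D(2)[OF m] borel_probs_D(2)[OF n] by (simp_all add: borel_eq_closed)
  qed (auto simp flip: cl)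
qed

lemma Metric_space_W1:
  assumes K: "compact (UNIV :: 'k::metric_space set)"
  shows "Metric_space (borel_probs :: 'k measure set) W1"
proof
  have self_0: "W1 \<mu> \<mu> = 0" if "\<mu> \<in> borel_probs" for \<mu> :: "'k measure"
    using W1_least[OF that that, of 0]
      W1_upper[OF K that that lipschitz_on_le[OF lipschitz_on_constant[of UNIV "0::real"]]]
    by force
  show nn: "0 \<le> W1 \<mu> \<nu>" for \<mu> \<nu> :: "'k measure"
  proof (cases "\<mu> \<in> borel_probs \<and> \<nu> \<in> borel_probs")
    case True
    have "1-lipschitz_on UNIV (\<lambda>_::'k. 0::real)"
      by (rule lipschitz_on_le[OF lipschitz_on_constant]) simp
    from W1_upper[OF K _ _ this, of \<mu> \<nu>] True show ?thesis by simp
  qed (auto simp: W1_def)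
  have "W1 \<mu> \<nu> \<le> W1 \<nu> \<mu>" for \<mu> \<nu> :: "'k measure"
  proof (cases "\<mu> \<in> borel_probs \<and> \<nu> \<in> borel_probs")
    case True
    show ?thesis
    proof (rule W1_least)
      fix f :: "'k \<Rightarrow> real" assume "1-lipschitz_on UNIV f"
      then have "1-lipschitz_on UNIV (\<lambda>x. - f x)"
        by (rule lipschitz_on_minus)
      from W1_upper[OF K _ _ this, of \<nu> \<mu>] True
      show "(\<integral>x. f x \<partial>\<mu>) - (\<integral>x. f x \<partial>\<nu>) \<le> W1 \<nu> \<mu>" by simp
    qed (use True in auto)
  qed (auto simp: W1_def)
  then show sym: "W1 \<mu> \<nu> = W1 \<nu> \<mu>" for \<mu> \<nu> :: "'k measure"
    by (simp add: order_antisym)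
  show "W1 \<mu> \<nu> = 0 \<longleftrightarrow> \<mu> = \<nu>" if "\<mu> \<in> borel_probs" "\<nu> \<in> borel_probs" for \<mu> \<nu> :: "'k measure"
    using W1_eq_0D[OF K that] self_0 that sym[of \<mu> \<nu>] by auto
  show "W1 \<mu> \<xi> \<le> W1 \<mu> \<nu> + W1 \<nu> \<xi>"
    if "\<mu> \<in> borel_probs" "\<nu> \<in> borel_probs" "\<xi> \<in> borel_probs" for \<mu> \<nu> \<xi> :: "'k measure"
  proof (rule W1_least)
    fix f :: "'k \<Rightarrow> real" assume f: "1-lipschitz_on UNIV f"
    show "(\<integral>x. f x \<partial>\<mu>) - (\<integral>x. f x \<partial>\<xi>) \<le> W1 \<mu> \<nu> + W1 \<nu> \<xi>"
      using W1_upper[OF K that(1,2) f] W1_upper[OF K that(2,3) f] by linarith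
  qed (use that in auto)
qed

context Metric_space
begin

lemma compactsD:
  assumes "P \<in> compacts"
  shows "P \<noteq> {}" "P \<subseteq> M" "compactin mtopology P"
  using assms compactin_subset_topspace by (fastforce simp: compacts_def)+

lemma dist_to_set_le: "p \<in> P \<Longrightarrow> dist_to_set x P \<le> d x p"
  unfolding dist_to_set_def by (rule cINF_lower) (auto intro!: bdd_belowI2[where m = 0])

lemma dist_to_set_nonneg: "P \<noteq> {} \<Longrightarrow> 0 \<le> dist_to_set x P"
  unfolding dist_to_set_def by (rule cINF_greatest) auto

lemma bdd_dist_to_set:
  assumes "P \<in> compacts" "Q \<in> compacts"
  shows "bdd_above ((\<lambda>p. dist_to_set p Q) ` P)"
proof -
  obtain q where q: "q \<in> Q" "q \<in> M" using compactsD[OF assms(2)] by auto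
  have "mbounded P" using compactsD[OF assms(1)] compactin_imp_mbounded by blast
  then obtain a B where aB: "P \<subseteq> mcball a B" by (auto simp: mbounded_def)
  show ?thesis
  proof (rule bdd_aboveI2)
    fix p assume "p \<in> P"
    then have "a \<in> M" "p \<in> M" "d a p \<le> B" using aB by auto
    then have "d p q \<le> B + d a q"
      using triangle[of p a q] q commute[of p a] by auto
    then show "dist_to_set p Q \<le> B + d a q"
      using dist_to_set_le[OF q(1), of p] by simp
  qed
qed

lemma dist_to_set_upper:
  assumes "P \<in> compacts" "Q \<in> compacts" "p \<in> P"
  shows "dist_to_set p Q \<le> (SUP p\<in>P. dist_to_set p Q)"
  using assms bdd_dist_to_set by (intro cSUP_upper) auto

lemma excess_nonneg:
  assumes "P \<in> compacts" "Q \<in> compacts"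
  shows "0 \<le> (SUP p\<in>P. dist_to_set p Q)"
proof -
  obtain p where "p \<in> P" using compactsD[OF assms(1)] by auto
  then show ?thesis
    using dist_to_set_upper[OF assms] dist_to_set_nonneg[of Q p] compactsD[OF assms(2)]
    by force
qed

lemma excess_0D:
  assumes PQ: "P \<in> compacts" "Q \<in> compacts" and le: "(SUP p\<in>P. dist_to_set p Q) \<le> 0"
  shows "P \<subseteq> Q"
proof
  fix p assume p: "p \<in> P"
  then have pM: "p \<in> M" using compactsD[OF PQ(1)] by auto
  have 0: "dist_to_set p Q \<le> 0" using dist_to_set_upper[OF PQ p] le by simp
  have "closedin mtopology Q"
    using compactsD[OF PQ(2)] compactin_imp_closedin Hausdorff_space_mtopology by blast
  moreover have "p \<in> mtopology closure_of Q"
    unfolding metric_closure_of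
  proof (intro CollectI conjI allI impI pM)
    fix r :: real assume "0 < r"
    with 0 have "(INF q\<in>Q. d p q) < r" by (simp add: dist_to_set_def)
    then obtain q where "q \<in> Q" "d p q < r"
      using compactsD[OF PQ(2)] by (subst (asm) cINF_less_iff) (auto intro!: bdd_belowI2[where m = 0])
    then show "\<exists>y\<in>Q. y \<in> mball p r"
      using pM compactsD[OF PQ(2)] by auto
  qed
  ultimately show "p \<in> Q" by (simp add: closure_of_closedin)
qed

lemma excess_self:
  assumes "P \<in> compacts"
  shows "(SUP p\<in>P. dist_to_set p P) = 0"
proof (rule antisym)
  have "dist_to_set p P \<le> 0" if "p \<in> P" for p
    using dist_to_set_le[OF that, of p] that compactsD[OF assms] by auto
  then show "(SUP p\<in>P. dist_to_set p P) \<le> 0"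
    using compactsD[OF assms] by (intro cSUP_least) auto
qed (rule excess_nonneg[OF assms assms])

lemma excess_triangle:
  assumes P: "P \<in> compacts" and Q: "Q \<in> compacts" and R: "R \<in> compacts"
  shows "(SUP p\<in>P. dist_to_set p R) \<le> (SUP p\<in>P. dist_to_set p Q) + (SUP q\<in>Q. dist_to_set q R)"
proof (rule cSUP_least)
  fix p assume p: "p \<in> P"
  then have pM: "p \<in> M" using compactsD[OF P] by auto
  have "dist_to_set p R - (SUP q\<in>Q. dist_to_set q R) \<le> d p q" if q: "q \<in> Q" for q
  proof -
    have qM: "q \<in> M" using q compactsD[OF Q] by auto
    have "dist_to_set p R - d p q \<le> d q r" if "r \<in> R" for r
      using triangle[OF pM qM, of r] dist_to_set_le[OF that, of p] that compactsD[OF R] by auto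
    then have "dist_to_set p R - d p q \<le> dist_to_set q R"
      using compactsD[OF R] unfolding dist_to_set_def[of q] by (intro cINF_greatest) auto
    then show ?thesis using dist_to_set_upper[OF Q R q] by simp
  qed
  then have "dist_to_set p R - (SUP q\<in>Q. dist_to_set q R) \<le> dist_to_set p Q"
    using compactsD[OF Q] unfolding dist_to_set_def[of p Q] by (intro cINF_greatest) auto
  then show "dist_to_set p R \<le> (SUP p\<in>P. dist_to_set p Q) + (SUP q\<in>Q. dist_to_set q R)"
    using dist_to_set_upper[OF P Q p] by simp
qed (use compactsD[OF P] in auto)

lemma Metric_space_dH: "Metric_space compacts dH"
proof
  show "0 \<le> dH P Q" for P Q
    by (auto simp: dH_def intro!: add_nonneg_nonneg excess_nonneg)
  show "dH P Q = dH Q P" for P Q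
    by (auto simp: dH_def)
  show "dH P Q = 0 \<longleftrightarrow> P = Q" if "P \<in> compacts" "Q \<in> compacts" for P Q
    using that excess_0D[of P Q] excess_0D[of Q P] excess_nonneg[of P Q] excess_nonneg[of Q P]
      excess_self by (auto simp: dH_def)
  show "dH P R \<le> dH P Q + dH Q R" if "P \<in> compacts" "Q \<in> compacts" "R \<in> compacts" for P Q R
    using that excess_triangle[of P Q R] excess_triangle[of R Q P] by (simp add: dH_def)
qed

end

lemma Metric_space_hausdorff_W1:
  assumes "compact (UNIV :: 'k::metric_space set)"
  shows "Metric_space (compact_measure_sets :: 'k measure set set) hausdorff_W1"
  unfolding compact_measure_sets_def hausdorff_W1_def
  by (rule Metric_space.Metric_space_dH[OF Metric_space_W1[OF assms]])

end

theory Submission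
  imports Defs
begin

text \<open>
  The set \<open>M(K,T)\<close> of \<open>T\<close>-invariant measures depends on \<open>T\<close> upper semicontinuously: a limit of
  \<open>S n\<close>-invariant measures is \<open>T\<close>-invariant when \<open>S n\<close> converges to \<open>T\<close> uniformly
  (\<open>invariant_measures_subsequence\<close>). Fort's theorem (\<open>residual_continuity_points\<close>) says that such
  a map into the compact subsets of a compact metric space is continuous at all points of a
  residual set: for a closed ball \<open>B\<close>, the maps \<open>T\<close> with \<open>M(K,T)\<close> meeting \<open>B\<close> form a closed set;
  its frontier is nowhere dense, and away from the frontiers for countably many balls, the balls of
  a finite cover that \<open>M(K,T)\<close> meets do not change locally, which fixes \<open>M(K,T)\<close> up to a small
  Hausdorff error.

  The substance is that the probability measures on \<open>K\<close> are compact for \<open>W1\<close>. Instead of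
  representing positive functionals by measures, the proof reduces to the real line. Coding points
  by the balls that contain them gives a compact set \<open>C\<close> of reals, a continuous \<open>\<phi>\<close> from \<open>C\<close> onto
  \<open>K\<close>, and a Borel right inverse \<open>s\<close> of \<open>\<phi>\<close> (\<open>compact_metric_Borel_section\<close>). Moving measures to \<open>C\<close>
  with \<open>s\<close>, selecting a weakly convergent subsequence there by Helly's theorem, and moving the limit
  back with \<open>\<phi>\<close> proves weak sequential compactness (\<open>borel_probs_weakly_sequentially_compact\<close>). A
  finite partition of unity makes weak convergence uniform over 1-Lipschitz functions, so weak
  limits are \<open>W1\<close> limits (\<open>weakly_converges_imp_W1_tendsto_0\<close>).

  Existence of invariant measures is the Krylov-Bogolyubov argument; it, the compactness of
  \<open>M(K,T)\<close> and the semicontinuity all come from the same statement about limits of asymptotically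
  invariant measures (\<open>asymptotically_invariant_subsequence\<close>).
\<close>

section \<open>Semicontinuous set-valued maps are generically continuous\<close>

context Metric_space
begin

text \<open>
  A point of \<open>P\<close> lies in some ball of the cover, and then \<open>Q\<close> has a point in the same ball, at
  most one diameter away. So knowing which balls of a fine cover a compact set meets determines
  it up to a small Hausdorff error; this turns Hausdorff continuity into local constancy of
  finitely many yes-no questions.
\<close>

lemma excess_le_of_common_balls:
  assumes P: "P \<in> compacts" and Q: "Q \<in> compacts"
    and net: "M \<subseteq> (\<Union>a\<in>N. mball a e)"
    and meets: "\<And>a. a \<in> N \<Longrightarrow> P \<inter> mcball a e \<noteq> {} \<Longrightarrow> Q \<inter> mcball a e \<noteq> {}"
  shows "(SUP p\<in>P. dist_to_set p Q) \<le> 2 * e"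
proof (rule cSUP_least)
  show "P \<noteq> {}" using compactsD[OF P] by simp
next
  fix p assume p: "p \<in> P"
  then have "p \<in> M" using compactsD[OF P] by auto
  then obtain a where a: "a \<in> N" "p \<in> mball a e" using net by blast
  then have "P \<inter> mcball a e \<noteq> {}" using p mball_subset_mcball by blast
  then obtain q where q: "q \<in> Q" "q \<in> mcball a e" using meets a by blast
  have "d p q \<le> d p a + d a q" using a q by (intro triangle) auto
  also have "\<dots> \<le> 2 * e" using a q by (simp add: commute)
  finally show "dist_to_set p Q \<le> 2 * e" using dist_to_set_le[OF q(1), of p] by simp
qed

text \<open>
  Fort's theorem. For a ball \<open>B\<close>, the set of \<open>x\<close> with \<open>\<Phi> x\<close> meeting \<open>B\<close> is closed, so its frontier
  has empty interior, and off the frontier the question whether \<open>\<Phi> x\<close> meets \<open>B\<close> has a locally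
  constant answer. Compactness gives for every radius a finite cover by balls; avoiding the
  frontiers that belong to these countably many balls leaves a residual set. At a point \<open>x\<close>
  of that set, every \<open>y\<close> near \<open>x\<close> has \<open>\<Phi> y\<close> meeting the same balls of a given cover as \<open>\<Phi> x\<close>.
\<close>

theorem residual_continuity_points:
  fixes \<Phi> :: "'x::topological_space \<Rightarrow> 'a set"
  assumes M: "compact_space mtopology"
    and \<Phi>: "\<And>x. \<Phi> x \<in> compacts"
    and usc: "\<And>C. closedin mtopology C \<Longrightarrow> closed {x. \<Phi> x \<inter> C \<noteq> {}}"
  shows "\<exists>Y. residual Y \<and>
    (\<forall>x\<in>Y. topcontinuous_at euclidean (Metric_space.mtopology compacts dH) \<Phi> x)"
proof -
  interpret H: Metric_space compacts dH by (rule Metric_space_dH)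
  define e where "e n = inverse (real (Suc n))" for n
  have e: "e n > 0" for n by (simp add: e_def)
  have "mtotally_bounded M"
    using M by (simp add: compact_space_def compactin_imp_mtotally_bounded)
  then have "\<exists>N. finite N \<and> N \<subseteq> M \<and> M \<subseteq> (\<Union>a\<in>N. mball a (e n))" for n
    using e unfolding mtotally_bounded_def by blast
  then obtain N where N: "\<And>n. finite (N n)" "\<And>n. M \<subseteq> (\<Union>a\<in>N n. mball a (e n))"
    by metis
  define A where "A = (\<lambda>(n, a). {x. \<Phi> x \<inter> mcball a (e n) \<noteq> {}})"
  have clA: "closed (A i)" for i
    by (cases i) (auto simp: A_def intro: usc)
  \<comment> \<open>The pairs (scale, centre) are enumerated, because \<open>residual\<close> asks for a sequence of open sets.\<close>
  define I where "I = Sigma UNIV N"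
  have "countable I" unfolding I_def by (intro countable_SIGMA) (auto intro: countable_finite N)
  moreover have "I \<noteq> {}"
    using compactsD(1,2)[OF \<Phi>[of undefined]] N(2)[of 0] unfolding I_def by blast
  ultimately have I: "range (from_nat_into I) = I" by (simp add: range_from_nat_into)
  define G where "G k = - frontier (A (from_nat_into I k))" for k
  have "open (G k) \<and> closure (G k) = UNIV" for k
  proof -
    have "interior (frontier B) = {}" if "closed B" for B :: "'x set"
      using interior_mono[OF frontier_subset_closed[OF that]] interior_subset[of "frontier B"]
      by (auto simp: frontier_def)
    with clA show ?thesis by (simp add: G_def open_Compl closure_complement)
  qed
  then have "residual (\<Inter>k. G k)" unfolding residual_def by blast
  moreover have "topcontinuous_at euclidean H.mtopology \<Phi> x" if "x \<in> (\<Inter>k. G k)" for x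
    unfolding topcontinuous_at_def
  proof (intro conjI allI impI)
    have nfr: "x \<notin> frontier (A (n, a))" if "a \<in> N n" for n a
    proof -
      have "(n, a) \<in> range (from_nat_into I)" using that I by (simp add: I_def)
      with \<open>x \<in> (\<Inter>k. G k)\<close> show ?thesis by (auto simp: G_def)
    qed
    fix V assume V: "openin H.mtopology V \<and> \<Phi> x \<in> V"
    then obtain r where r: "r > 0" "H.mball (\<Phi> x) r \<subseteq> V"
      by (meson H.openin_mtopology)
    \<comment> \<open>Each of the two excesses in \<open>dH\<close> is bounded by \<open>2 * e n\<close>.\<close>
    obtain n where n: "e n < r / 4"
      using reals_Archimedean[of "r / 4"] r by (auto simp: e_def)
    define U where "U = (\<Inter>a\<in>N n. if x \<in> A (n, a) then interior (A (n, a)) else - A (n, a))"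
    have "open U" unfolding U_def by (intro open_INT N) (auto simp: clA open_Compl)
    moreover have "x \<in> U"
    proof -
      have "x \<in> interior (A (n, a))" if "a \<in> N n" "x \<in> A (n, a)" for a
        using nfr[OF that(1)] closure_subset that(2) by (fastforce simp: frontier_def)
      then show ?thesis unfolding U_def by (intro INT_I) simp
    qed
    moreover have "\<Phi> y \<in> V" if y: "y \<in> U" for y
    proof -
      have same: "y \<in> A (n, a) \<longleftrightarrow> x \<in> A (n, a)" if "a \<in> N n" for a
        using y that interior_subset[of "A (n, a)"] by (auto simp: U_def split: if_splits)
      have "(SUP p\<in>\<Phi> x. dist_to_set p (\<Phi> y)) \<le> 2 * e n"
        using same by (intro excess_le_of_common_balls[OF \<Phi> \<Phi> N(2)]) (auto simp: A_def)
      moreover have "(SUP p\<in>\<Phi> y. dist_to_set p (\<Phi> x)) \<le> 2 * e n"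
        using same by (intro excess_le_of_common_balls[OF \<Phi> \<Phi> N(2)]) (auto simp: A_def)
      ultimately have "dH (\<Phi> x) (\<Phi> y) < r"
        using n by (simp add: dH_def \<Phi>)
      then have "\<Phi> y \<in> H.mball (\<Phi> x) r" by (simp add: \<Phi>)
      then show ?thesis using r by blast
    qed
    ultimately show "\<exists>U. openin euclidean U \<and> x \<in> U \<and> (\<forall>y\<in>U. \<Phi> y \<in> V)" by auto
  qed (use \<Phi> in auto)
  ultimately show ?thesis by blast
qed

end

section \<open>Weak convergence\<close>

definition weakly_converges :: "(nat \<Rightarrow> 'k::metric_space measure) \<Rightarrow> 'k measure \<Rightarrow> bool" where
  "weakly_converges \<mu> \<nu> \<longleftrightarrow>
     (\<forall>f :: 'k \<Rightarrow> real. continuous_on UNIV f \<longrightarrow> (\<lambda>n. \<integral>x. f x \<partial>\<mu> n) \<longlonglongrightarrow> (\<integral>x. f x \<partial>\<nu>))"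

section \<open>A compact metric space as a continuous image of a compact set of reals\<close>

text \<open>
  The parametrisation of the Cantor set by its digits, up to the scaling factor \<open>2 / 3\<close>. In base 3
  digits 0 and 1 never produce two expansions of the same number.
\<close>

definition ternary :: "(nat \<Rightarrow> bool) \<Rightarrow> real" where
  "ternary b = (\<Sum>i. of_bool (b i) / 3 ^ i)"

lemma summable_ternary: "summable (\<lambda>i. of_bool (b i) / 3 ^ i :: real)"
  by (rule summable_comparison_test'[OF summable_geometric[of "1 / 3 :: real"]])
    (auto simp: power_divide)

lemma ternary_bounds: "0 \<le> ternary b" "ternary b \<le> 3 / 2"
proof -
  show "0 \<le> ternary b" unfolding ternary_def by (intro suminf_nonneg summable_ternary) simp
  have "ternary b \<le> (\<Sum>i. (1 / 3) ^ i)" unfolding ternary_def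
    by (intro suminf_le summable_ternary summable_geometric) (auto simp: power_divide)
  then show "ternary b \<le> 3 / 2" by (simp add: suminf_geometric)
qed

lemma ternary_shift: "ternary b = of_bool (b 0) + ternary (\<lambda>i. b (Suc i)) / 3"
proof -
  have "ternary (\<lambda>i. b (Suc i)) / 3 = (\<Sum>i. of_bool (b (Suc i)) / 3 ^ Suc i)"
    unfolding ternary_def by (subst suminf_divide[OF summable_ternary, symmetric]) (simp add: mult.commute)
  also have "\<dots> = ternary b - of_bool (b 0)"
    using suminf_split_head[OF summable_ternary[of b]] by (simp add: ternary_def)
  finally show ?thesis by linarith
qed

text \<open>
  The digits are recovered one at a time: the tail after digit 0 contributes at most \<open>1 / 2\<close>, so
  digit 0 is determined by the value, and what remains is the value of the shifted sequence.
\<close>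

lemma inj_ternary: "inj ternary"
proof (rule injI, rule ext)
  show "b i = c i" if "ternary b = ternary c" for b c i
    using that
  proof (induction i arbitrary: b c)
    case 0
    then show ?case
      using ternary_shift[of b] ternary_shift[of c] ternary_bounds[of "\<lambda>i. b (Suc i)"]
        ternary_bounds[of "\<lambda>i. c (Suc i)"] by (auto simp: of_bool_def split: if_splits)
  next
    case (Suc i)
    have "b 0 = c 0"
      using Suc.prems ternary_shift[of b] ternary_shift[of c] ternary_bounds[of "\<lambda>i. b (Suc i)"]
        ternary_bounds[of "\<lambda>i. c (Suc i)"] by (auto simp: of_bool_def split: if_splits)
    then have "ternary (\<lambda>i. b (Suc i)) = ternary (\<lambda>i. c (Suc i))"
      using Suc.prems ternary_shift[of b] ternary_shift[of c] by simp
    then show ?case by (rule Suc.IH)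
  qed
qed

lemma continuous_on_ternary: "continuous_on UNIV ternary"
proof -
  have "uniform_limit UNIV (\<lambda>n b. \<Sum>i<n. of_bool (b i) / 3 ^ i :: real) ternary sequentially"
    unfolding ternary_def[abs_def]
    by (rule Weierstrass_m_test[where M = "\<lambda>i. (1 / 3) ^ i"])
      (auto simp: power_one_over intro: summable_geometric[of "1 / 3 :: real", simplified power_one_over])
  moreover have c: "continuous_on UNIV (\<lambda>b :: nat \<Rightarrow> bool. of_bool (b i) :: real)" for i
  proof (rule continuous_on_compose2[OF _ continuous_on_product_coordinates])
    show "continuous_on UNIV (of_bool :: bool \<Rightarrow> real)"
      by (simp add: continuous_on_open_vimage open_discrete)
  qed simp
  ultimately show ?thesis
    by (intro uniform_limit_theorem[where F = sequentially] always_eventually)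
      (auto intro!: continuous_intros c)
qed

lemma compact_UNIV_bool_seq: "compact (UNIV :: (nat \<Rightarrow> bool) set)"
proof -
  have "compact_space (product_topology (\<lambda>_::nat. euclidean :: bool topology) UNIV)"
    unfolding compact_space_product_topology
    by (simp add: compact_space_def finite_imp_compact)
  then show ?thesis
    by (simp add: euclidean_product_topology compact_space_def)
qed

text \<open>
  The balls have the radius \<open>1 / (n + 1)\<close> around the points of a finite net of the same fineness,
  for all \<open>n\<close>. Both strict inequalities are needed later: they keep \<open>x\<close> out of the complement of the
  open ball and \<open>y\<close> out of the closed ball, so that both alternatives can be taken closed.
\<close>

lemma compact_metric_separating_balls:
  assumes K: "compact (UNIV :: 'k::metric_space set)"
  obtains p :: "nat \<Rightarrow> 'k::metric_space" and r :: "nat \<Rightarrow> real"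
  where "\<And>x y. x \<noteq> y \<Longrightarrow> \<exists>i. dist (p i) x < r i \<and> r i < dist (p i) y"
proof -
  define e where "e n = inverse (real (Suc n))" for n
  have e: "e n > 0" for n by (simp add: e_def)
  have "\<exists>N::'k set. finite N \<and> UNIV \<subseteq> (\<Union>a\<in>N. ball a (e n))" for n
    using seq_compact_imp_totally_bounded[OF compact_imp_seq_compact[OF K], rule_format, OF e[of n]]
    by blast
  then obtain N :: "nat \<Rightarrow> 'k set"
    where N: "\<And>n. finite (N n)" "\<And>n. UNIV \<subseteq> (\<Union>a\<in>N n. ball a (e n))"
    by metis
  define I where "I = Sigma UNIV N"
  have "countable I" unfolding I_def by (intro countable_SIGMA) (auto intro: countable_finite N)
  moreover have "I \<noteq> {}" using N(2)[of 0] unfolding I_def by blast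
  ultimately have I: "range (from_nat_into I) = I" by (simp add: range_from_nat_into)
  show thesis
  proof (rule that)
    fix x y :: 'k assume "x \<noteq> y"
    then obtain n where n: "e n < dist x y / 2"
      using reals_Archimedean[of "dist x y / 2"] by (auto simp: e_def)
    obtain a where a: "a \<in> N n" "dist a x < e n" using N(2)[of n] by (auto simp: subset_iff)
    then have "(n, a) \<in> range (from_nat_into I)" using I by (simp add: I_def)
    then obtain i where "from_nat_into I i = (n, a)" by (metis imageE)
    moreover have "e n < dist a y" using n a dist_triangle[of x y a] by (simp add: dist_commute)
    ultimately show "\<exists>i. dist (snd (from_nat_into I i)) x < e (fst (from_nat_into I i)) \<and>
        e (fst (from_nat_into I i)) < dist (snd (from_nat_into I i)) y"
      using a by (intro exI[of _ i]) simp
  qed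
qed

text \<open>
  Code a point \<open>x\<close> by the bits saying which closed balls of a separating sequence contain it. The
  code \<open>x \<mapsto> b\<close> is in general only Borel, but the relation \<open>\<Gamma>\<close> that allows \<open>x\<close> in the closed ball for bit 1 and
  in the complement of the open ball for bit 0 is closed, hence compact, and since the balls
  separate points, \<open>b\<close> determines \<open>x\<close> on \<open>\<Gamma>\<close>. Reading \<open>b\<close> in base 3 therefore maps \<open>\<Gamma>\<close>
  homeomorphically onto a compact set of reals; \<open>\<phi>\<close> is the inverse followed by the projection to
  \<open>x\<close>. This makes measures on \<open>K\<close> accessible to theorems about measures on the real line: \<open>s\<close>
  moves them there, and \<open>\<phi>\<close> moves them back without destroying weak limits.
\<close>

proposition compact_metric_Borel_section:
  assumes K: "compact (UNIV :: 'k::metric_space set)"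
  obtains C :: "real set" and \<phi> :: "real \<Rightarrow> 'k::metric_space" and s :: "'k \<Rightarrow> real"
  where "compact C" "continuous_on C \<phi>" "s \<in> borel_measurable borel"
    "\<And>x. s x \<in> C" "\<And>x. \<phi> (s x) = x"
proof -
  obtain p :: "nat \<Rightarrow> 'k" and r where
    sep: "\<And>x y. x \<noteq> y \<Longrightarrow> \<exists>i. dist (p i) x < r i \<and> r i < dist (p i) y"
    using compact_metric_separating_balls[OF K] by blast
  define F where "F i = (if i then (\<lambda>j. cball (p j) (r j)) else (\<lambda>j. - ball (p j) (r j)))" for i
  define \<Gamma> where "\<Gamma> = {(b, x). \<forall>j. x \<in> F (b j) j}"
  have "closed {z :: (nat \<Rightarrow> bool) \<times> 'k. snd z \<in> F (fst z j) j}" for j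
  proof -
    have c: "continuous_on UNIV (\<lambda>z :: (nat \<Rightarrow> bool) \<times> 'k. fst z j)"
      by (rule continuous_on_product_then_coordinatewise) (intro continuous_intros)
    have "closed {z :: (nat \<Rightarrow> bool) \<times> 'k. fst z j = i}" for i
      by (intro closed_Collect_eq c continuous_intros)
    moreover have "closed {z :: (nat \<Rightarrow> bool) \<times> 'k. dist (p j) (snd z) \<le> r j}"
      "closed {z :: (nat \<Rightarrow> bool) \<times> 'k. r j \<le> dist (p j) (snd z)}"
      by (intro closed_Collect_le continuous_intros)+
    ultimately have "closed (({z :: (nat \<Rightarrow> bool) \<times> 'k. fst z j = True} \<inter> {z. dist (p j) (snd z) \<le> r j}) \<union>
        ({z. fst z j = False} \<inter> {z. r j \<le> dist (p j) (snd z)}))"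
      by (intro closed_Un closed_Int)
    also have "({z :: (nat \<Rightarrow> bool) \<times> 'k. fst z j = True} \<inter> {z. dist (p j) (snd z) \<le> r j}) \<union>
        ({z. fst z j = False} \<inter> {z. r j \<le> dist (p j) (snd z)}) = {z. snd z \<in> F (fst z j) j}"
      by (auto simp: F_def)
    finally show ?thesis .
  qed
  then have "closed (\<Inter>j. {z :: (nat \<Rightarrow> bool) \<times> 'k. snd z \<in> F (fst z j) j})" by blast
  also have "(\<Inter>j. {z :: (nat \<Rightarrow> bool) \<times> 'k. snd z \<in> F (fst z j) j}) = \<Gamma>"
    by (auto simp: \<Gamma>_def)
  finally have "compact (UNIV \<times> UNIV \<inter> \<Gamma>)"
    by (intro compact_Int_closed compact_Times compact_UNIV_bool_seq K)
  then have cG: "compact \<Gamma>" by simp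
  define h where "h z = ternary (fst z)" for z :: "(nat \<Rightarrow> bool) \<times> 'k"
  have ch: "continuous_on \<Gamma> h" unfolding h_def
    by (rule continuous_on_compose2[OF continuous_on_ternary]) (auto intro: continuous_intros)
  have inj: "inj_on h \<Gamma>"
  proof (rule inj_onI)
    fix z w assume z: "z \<in> \<Gamma>" and w: "w \<in> \<Gamma>" and eq: "h z = h w"
    obtain b x where zb: "z = (b, x)" by fastforce
    obtain y where wb: "w = (b, y)"
      using eq injD[OF inj_ternary] by (cases w) (auto simp: h_def zb)
    have "x = y"
    proof (rule ccontr)
      assume "x \<noteq> y"
      from sep[OF this] obtain i where "dist (p i) x < r i" "r i < dist (p i) y" by blast
      moreover have "x \<in> F (b i) i" "y \<in> F (b i) i" using z w by (auto simp: \<Gamma>_def zb wb)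
      ultimately show False by (auto simp: F_def split: if_splits)
    qed
    then show "z = w" by (simp add: zb wb)
  qed
  \<comment> \<open>A point on a bounding sphere would be allowed either bit; the code chooses the closed ball.\<close>
  define c where "c x j \<longleftrightarrow> dist (p j) x \<le> r j" for x j
  have cx: "(c x, x) \<in> \<Gamma>" for x by (auto simp: \<Gamma>_def F_def c_def)
  define g where "g = inv_into \<Gamma> h"
  have g: "g (h z) = z" if "z \<in> \<Gamma>" for z using inv_into_f_f[OF inj that] by (simp add: g_def)
  show thesis
  proof (rule that)
    show "compact (h ` \<Gamma>)" by (rule compact_continuous_image[OF ch cG])
    show "continuous_on (h ` \<Gamma>) (\<lambda>t. snd (g t))"
      by (intro continuous_on_snd continuous_on_inv[OF ch cG]) (simp add: g)
    have "(\<lambda>x. of_bool (c x j) :: real) \<in> borel_measurable borel" for j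
    proof -
    have "(\<lambda>x. of_bool (c x j) :: real) = indicator (cball (p j) (r j))"
      by (auto simp: c_def indicator_def)
    then show ?thesis by (simp add: borel_measurable_indicator)
  qed
    then show "(\<lambda>x. ternary (c x)) \<in> borel_measurable borel"
      unfolding ternary_def by (intro borel_measurable_suminf) auto
    show "ternary (c x) \<in> h ` \<Gamma>" for x
      using cx[of x] by (force simp: h_def)
    show "snd (g (ternary (c x))) = x" for x
      using g[OF cx[of x]] by (simp add: h_def)
  qed
qed

section \<open>Weak sequential compactness of the probability measures\<close>

lemma compact_continuous_bounded:
  fixes f :: "'k::metric_space \<Rightarrow> real"
  assumes "compact (UNIV :: 'k set)" "continuous_on UNIV f"
  obtains B where "\<And>x. \<bar>f x\<bar> \<le> B"
  using compact_imp_bounded[OF compact_continuous_image[OF assms(2,1)]]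
  by (auto simp: bounded_iff)

lemma measurable_borel_probs_continuous:
  fixes f :: "'k::metric_space \<Rightarrow> 'b::topological_space"
  assumes "\<mu> \<in> borel_probs" "continuous_on UNIV f"
  shows "f \<in> borel_measurable \<mu>"
  using borel_measurable_continuous_onI[OF assms(2)] borel_probs_D(2)[OF assms(1)]
  by (simp cong: measurable_cong_sets)

lemma integrable_continuous_on_compact:
  fixes f :: "'k::metric_space \<Rightarrow> real"
  assumes K: "compact (UNIV :: 'k set)" and \<mu>: "\<mu> \<in> borel_probs" and f: "continuous_on UNIV f"
  shows "integrable \<mu> f"
proof -
  interpret prob_space \<mu> using borel_probs_D[OF \<mu>] by simp
  obtain B where "\<And>x. \<bar>f x\<bar> \<le> B" using compact_continuous_bounded[OF K f] by blast
  then show ?thesis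
    using measurable_borel_probs_continuous[OF \<mu> f] by (intro integrable_const_bound[of _ B]) auto
qed

text \<open>
  The images of the measures under the Borel section \<open>s\<close> live on one compact set \<open>C\<close> of reals, so
  they are tight, and Helly's selection theorem provides a weak limit \<open>L\<close> of a subsequence. As \<open>C\<close> is
  closed, \<open>L\<close> is carried by \<open>C\<close>, where \<open>\<phi>\<close> is continuous. A continuous \<open>f\<close> on \<open>K\<close> yields \<open>f \<circ> \<phi>\<close> on
  \<open>C\<close>, which Tietze's theorem extends to a bounded continuous function on the line; hence the image
  of \<open>L\<close> under \<open>\<phi>\<close> is the weak limit sought.
\<close>

theorem borel_probs_weakly_sequentially_compact:
  fixes \<mu> :: "nat \<Rightarrow> 'k::metric_space measure"
  assumes K: "compact (UNIV :: 'k set)" and \<mu>: "\<And>n. \<mu> n \<in> borel_probs"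
  obtains \<nu> and r :: "nat \<Rightarrow> nat"
  where "\<nu> \<in> borel_probs" "strict_mono r" "weakly_converges (\<lambda>n. \<mu> (r n)) \<nu>"
proof -
  obtain C :: "real set" and \<phi> :: "real \<Rightarrow> 'k::metric_space" and s where
    C: "compact C" and \<phi>: "continuous_on C \<phi>" and s: "s \<in> borel_measurable borel"
    and sC: "\<And>x. s x \<in> C" and \<phi>s: "\<And>x. \<phi> (s x) = x"
    using compact_metric_Borel_section[OF K] by blast
  interpret \<mu>: prob_space "\<mu> n" for n using borel_probs_D[OF \<mu>] by simp
  have s\<mu>: "s \<in> borel_measurable (\<mu> n)" for n
    using s borel_probs_D(2)[OF \<mu>] by (simp cong: measurable_cong_sets)
  define \<kappa> where "\<kappa> n = distr (\<mu> n) borel s" for n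
  have \<kappa>: "real_distribution (\<kappa> n)" for n
    unfolding \<kappa>_def by (rule \<mu>.real_distribution_distr[OF s\<mu>])
  have "tight \<kappa>"
    unfolding tight_def
  proof (intro conjI allI impI \<kappa>)
    fix \<epsilon> :: real assume \<epsilon>: "\<epsilon> > 0"
    obtain B where B: "\<And>t. t \<in> C \<Longrightarrow> \<bar>t\<bar> \<le> B"
      using compact_imp_bounded[OF C] by (auto simp: bounded_iff)
    have "s x \<in> {- B - 1<..B}" for x
      using B[OF sC[of x]] by (simp add: abs_le_iff)
    then have "s -` {- B - 1<..B} \<inter> space (\<mu> n) = space (\<mu> n)" for n by blast
    then have "measure (\<kappa> n) {- B - 1<..B} = 1" for n
      by (simp add: \<kappa>_def measure_distr[OF s\<mu>] \<mu>.prob_space)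
    moreover have "- B - 1 < B" using B[OF sC[of undefined]] by linarith
    ultimately show "\<exists>a b. a < b \<and> (\<forall>n. 1 - \<epsilon> < measure (\<kappa> n) {a<..b})"
      using \<epsilon> by (intro exI[of _ "- B - 1"] exI[of _ B]) simp
  qed
  then obtain r L where r: "strict_mono (r :: nat \<Rightarrow> nat)" and L: "real_distribution L"
    and conv: "weak_conv_m (\<kappa> \<circ> id \<circ> r) L"
    using tight_imp_convergent_subsubsequence[of \<kappa> id] strict_mono_id by blast
  interpret L: real_distribution L by (rule L)
  have lim: "(\<lambda>n. \<integral>x. f (s x) \<partial>\<mu> (r n)) \<longlonglongrightarrow> (\<integral>t. f t \<partial>L)"
    if f: "continuous_on UNIV f" and B: "\<And>t. \<bar>f t\<bar> \<le> B" for f :: "real \<Rightarrow> real" and B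
  proof -
    have "(\<lambda>n. \<integral>t. f t \<partial>(\<kappa> \<circ> id \<circ> r) n) \<longlonglongrightarrow> (\<integral>t. f t \<partial>L)"
      by (rule weak_conv_imp_integral_bdd_continuous_conv[OF _ _ conv, where B = B])
        (use f B \<kappa> L in \<open>auto simp: continuous_on_eq_continuous_at\<close>)
    moreover have "(\<integral>t. f t \<partial>(\<kappa> \<circ> id \<circ> r) n) = (\<integral>x. f (s x) \<partial>\<mu> (r n))" for n
      using borel_measurable_continuous_onI[OF f] by (simp add: \<kappa>_def integral_distr[OF s\<mu>])
    ultimately show ?thesis by simp
  qed
  have Cne: "C \<noteq> {}" using sC by blast
  have "AE t in L. t \<in> C"
  proof -
    \<comment> \<open>This test function vanishes exactly on \<open>C\<close>, and the approximating measures live on \<open>C\<close>.\<close>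
    let ?g = "\<lambda>t. min 1 (infdist t C)"
    have cg: "continuous_on UNIV ?g" by (intro continuous_intros)
    have bg: "\<bar>?g t\<bar> \<le> 1" for t using infdist_nonneg[of t C] by simp
    have "(\<lambda>n. 0) \<longlonglongrightarrow> (\<integral>t. ?g t \<partial>L)"
      using lim[OF cg bg] sC by simp
    then have 0: "(\<integral>t. ?g t \<partial>L) = 0" using LIMSEQ_unique tendsto_const by blast
    have "?g \<in> borel_measurable L"
      using borel_measurable_continuous_onI[OF cg] by simp
    then have "integrable L ?g" using bg by (intro L.integrable_const_bound[of _ 1]) auto
    then have "AE t in L. ?g t = 0"
      using 0 by (subst (asm) integral_nonneg_eq_0_iff_AE) (auto simp: infdist_nonneg)
    then show ?thesis
    proof eventually_elim
      case (elim t)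
      then have "infdist t C = 0" by (simp add: min_def split: if_splits)
      then show ?case
        using in_closed_iff_infdist_zero[OF compact_imp_closed[OF C] Cne] by blast
    qed
  qed
  \<comment> \<open>Outside \<open>C\<close>, a null set of \<open>L\<close>, any constant value makes \<open>\<phi>\<close> Borel.\<close>
  define \<psi> where "\<psi> t = (if t \<in> C then \<phi> t else undefined)" for t
  have "\<psi> \<in> borel_measurable borel" unfolding \<psi>_def
    by (rule borel_measurable_continuous_on_if)
      (use C \<phi> in \<open>auto intro: borel_closed compact_imp_closed\<close>)
  then have \<psi>: "\<psi> \<in> measurable L borel" by simp
  define \<nu> where "\<nu> = distr L borel \<psi>"
  have "\<nu> \<in> borel_probs" using L.prob_space_distr[OF \<psi>] by (simp add: borel_probs_def \<nu>_def)
  moreover have "weakly_converges (\<lambda>n. \<mu> (r n)) \<nu>"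
    unfolding weakly_converges_def
  proof (intro allI impI)
    fix f :: "'k \<Rightarrow> real" assume f: "continuous_on UNIV f"
    obtain B where B: "\<And>x. \<bar>f x\<bar> \<le> B" using compact_continuous_bounded[OF K f] by blast
    have "continuous_on C (f \<circ> \<phi>)"
      using continuous_on_compose[OF \<phi>] f continuous_on_subset by blast
    moreover have "0 \<le> B" using B[of undefined] by linarith
    ultimately obtain g where g: "continuous_on UNIV g" "\<And>t. t \<in> C \<Longrightarrow> g t = f (\<phi> t)" "\<And>t. \<bar>g t\<bar> \<le> B"
      using Tietze[of C "f \<circ> \<phi>" UNIV B] compact_imp_closed[OF C] B by auto
    have "(\<lambda>n. \<integral>x. f x \<partial>\<mu> (r n)) \<longlonglongrightarrow> (\<integral>t. g t \<partial>L)"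
      using lim[OF g(1,3)] g(2)[OF sC] \<phi>s by simp
    also have "(\<integral>t. g t \<partial>L) = (\<integral>t. f (\<psi> t) \<partial>L)"
    proof (rule integral_cong_AE)
      show "g \<in> borel_measurable L" using borel_measurable_continuous_onI[OF g(1)] by simp
      show "(\<lambda>t. f (\<psi> t)) \<in> borel_measurable L"
        by (rule measurable_compose[OF \<psi> borel_measurable_continuous_onI[OF f]])
      show "AE t in L. g t = f (\<psi> t)"
        using \<open>AE t in L. t \<in> C\<close> by eventually_elim (simp add: \<psi>_def g)
    qed
    also have "\<dots> = (\<integral>x. f x \<partial>\<nu>)"
      unfolding \<nu>_def by (rule integral_distr[OF \<psi> borel_measurable_continuous_onI[OF f], symmetric])
    finally show "(\<lambda>n. \<integral>x. f x \<partial>\<mu> (r n)) \<longlonglongrightarrow> (\<integral>x. f x \<partial>\<nu>)" .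
  qed
  ultimately show thesis using that r by blast
qed



section \<open>Weak convergence implies convergence in the Kantorovich-Rubinstein distance\<close>

lemma partition_of_unity_subordinate_to_balls:
  assumes K: "compact (UNIV :: 'k::metric_space set)" and e: "e > 0"
  shows "\<exists>(N :: 'k set) (w :: 'k \<Rightarrow> 'k \<Rightarrow> real). finite N \<and> (\<forall>a. continuous_on UNIV (w a)) \<and>
    (\<forall>a x. 0 \<le> w a x) \<and> (\<forall>a x. w a x \<noteq> 0 \<longrightarrow> dist a x < e) \<and> (\<forall>x. (\<Sum>a\<in>N. w a x) = 1)"
proof -
  obtain N :: "'k set" where N: "finite N" "UNIV \<subseteq> (\<Union>a\<in>N. ball a e)"
    using seq_compact_imp_totally_bounded[OF compact_imp_seq_compact[OF K], rule_format, OF e]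
    by blast
  define t where "t a x = max 0 (e - dist a x)" for a x :: 'k
  define h where "h x = (\<Sum>a\<in>N. t a x)" for x
  have t0: "0 \<le> t a x" for a x by (simp add: t_def)
  have h: "h x > 0" for x
  proof -
    obtain a where "a \<in> N" "dist a x < e" using N(2) by (auto simp: subset_iff)
    then show ?thesis unfolding h_def
      using t0 by (intro sum_pos2[OF N(1), of a]) (auto simp: t_def)
  qed
  have ct: "continuous_on UNIV (t a)" for a
    unfolding t_def[abs_def] by (intro continuous_intros)
  show ?thesis
  proof (intro exI[of _ N] exI[of _ "\<lambda>a x. t a x / h x"] conjI allI impI N(1))
    show "continuous_on UNIV (\<lambda>x. t a x / h x)" for a
      using h ct unfolding h_def by (intro continuous_intros) (auto simp: less_le)
    show "0 \<le> t a x / h x" for a x using t0[of a x] h[of x] by simp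
    show "dist a x < e" if "t a x / h x \<noteq> 0" for a x
      using that by (auto simp: t_def max_def split: if_splits)
    show "(\<Sum>a\<in>N. t a x / h x) = 1" for x
      using h[of x] by (simp add: h_def flip: sum_divide_distrib)
  qed
qed

text \<open>
  Weak convergence treats one test function at a time, while \<open>W1\<close> is a supremum over all
  1-Lipschitz functions. The two are reconciled by a finite partition of unity \<open>w\<close> subordinate to
  balls of radius \<open>e\<close>: every 1-Lipschitz \<open>f\<close> is uniformly \<open>e\<close>-close to the combination of the \<open>w a\<close>
  with coefficients \<open>f a\<close>. After subtracting a constant from \<open>f\<close> these coefficients are bounded by
  the diameter, so \<open>W1\<close> is controlled by the integrals of the finitely many functions \<open>w a\<close>.
\<close>

theorem weakly_converges_imp_W1_tendsto_0:
  fixes \<mu> :: "nat \<Rightarrow> 'k::metric_space measure"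
  assumes K: "compact (UNIV :: 'k set)" and \<mu>: "\<And>n. \<mu> n \<in> borel_probs" and \<nu>: "\<nu> \<in> borel_probs"
    and lim: "weakly_converges \<mu> \<nu>"
  shows "(\<lambda>n. W1 (\<mu> n) \<nu>) \<longlonglongrightarrow> 0"
proof (rule order_tendstoI)
  fix c :: real assume "c < 0"
  then show "\<forall>\<^sub>F n in sequentially. c < W1 (\<mu> n) \<nu>"
    using Metric_space.nonneg[OF Metric_space_W1[OF K]] by (auto intro!: always_eventually elim: less_le_trans)
next
  fix c :: real assume c: "0 < c"
  define e where "e = c / 3"
  have e: "e > 0" using c by (simp add: e_def)
  obtain N and w :: "'k \<Rightarrow> 'k \<Rightarrow> real" where N: "finite N" and cw: "\<And>a. continuous_on UNIV (w a)"
    and w0: "\<And>a x. 0 \<le> w a x" and wd: "\<And>a x. w a x \<noteq> 0 \<Longrightarrow> dist a x < e"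
    and w1: "\<And>x. (\<Sum>a\<in>N. w a x) = 1"
    using partition_of_unity_subordinate_to_balls[OF K e] by auto
  obtain z D where D: "\<And>x :: 'k. dist z x \<le> D"
    using compact_imp_bounded[OF K] by (auto simp: bounded_def)
  define \<delta> where "\<delta> n = (\<Sum>a\<in>N. \<bar>(\<integral>x. w a x \<partial>\<mu> n) - (\<integral>x. w a x \<partial>\<nu>)\<bar>)" for n
  have bound: "W1 (\<mu> n) \<nu> \<le> 2 * e + D * \<delta> n" for n
  proof (rule W1_least[OF \<mu> \<nu>])
    fix f :: "'k \<Rightarrow> real" assume f: "1-lipschitz_on UNIV f"
    define g where "g x = f x - f z" for x
    have gl: "\<bar>g x - g y\<bar> \<le> dist x y" for x y
      using lipschitz_onD[OF f, of x y] by (simp add: g_def dist_real_def)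
    have gD: "\<bar>g x\<bar> \<le> D" for x
      using gl[of x z] D[of x] by (simp add: g_def dist_commute)
    have cg: "continuous_on UNIV g"
      unfolding g_def using lipschitz_on_continuous_on[OF f] by (intro continuous_intros)
    define q where "q x = (\<Sum>a\<in>N. w a x * g a)" for x
    have cq: "continuous_on UNIV q" unfolding q_def by (intro continuous_intros cw)
    have gq: "\<bar>g x - q x\<bar> \<le> e" for x
    proof -
      have "g x - q x = (\<Sum>a\<in>N. w a x * (g x - g a))"
        using w1[of x] by (simp add: q_def right_diff_distrib sum_subtractf flip: sum_distrib_right)
      also have "\<bar>\<dots>\<bar> \<le> (\<Sum>a\<in>N. w a x * e)"
      proof (intro order.trans[OF sum_abs] sum_mono)
        fix a
        have "\<bar>g x - g a\<bar> \<le> e" if "w a x \<noteq> 0"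
          using gl[of x a] wd[OF that] by (simp add: dist_commute)
        then show "\<bar>w a x * (g x - g a)\<bar> \<le> w a x * e"
          using w0[of a x] by (cases "w a x = 0") (auto simp: abs_mult intro!: mult_left_mono)
      qed
      also have "\<dots> = e" using w1[of x] by (simp flip: sum_distrib_right)
      finally show ?thesis .
    qed
    have close: "\<bar>(\<integral>x. f x \<partial>m) - f z - (\<Sum>a\<in>N. (\<integral>x. w a x \<partial>m) * g a)\<bar> \<le> e"
      if m: "m \<in> borel_probs" for m
    proof -
      interpret m: prob_space m using borel_probs_D[OF m] by simp
      note int = integrable_continuous_on_compact[OF K m]
      have "(\<integral>x. g x \<partial>m) = (\<integral>x. f x \<partial>m) - f z"
        using int[OF lipschitz_on_continuous_on[OF f]] by (simp add: g_def m.prob_space)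
      moreover have "(\<integral>x. q x \<partial>m) = (\<Sum>a\<in>N. (\<integral>x. w a x \<partial>m) * g a)"
        unfolding q_def using int[OF cw] by simp
      moreover have "\<bar>(\<integral>x. g x \<partial>m) - (\<integral>x. q x \<partial>m)\<bar> \<le> e"
      proof -
        have "\<bar>\<integral>x. g x - q x \<partial>m\<bar> \<le> (\<integral>x. \<bar>g x - q x\<bar> \<partial>m)" by (rule integral_abs_bound)
        also have "\<dots> \<le> (\<integral>x. e \<partial>m)"
          using gq int[OF cg] int[OF cq] by (intro integral_mono) auto
        finally show ?thesis using int[OF cg] int[OF cq] by (simp add: m.prob_space)
      qed
      ultimately show ?thesis by simp
    qed
    have "(\<Sum>a\<in>N. (\<integral>x. w a x \<partial>\<mu> n) * g a) - (\<Sum>a\<in>N. (\<integral>x. w a x \<partial>\<nu>) * g a) =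
        (\<Sum>a\<in>N. ((\<integral>x. w a x \<partial>\<mu> n) - (\<integral>x. w a x \<partial>\<nu>)) * g a)"
      by (simp add: sum_subtractf left_diff_distrib)
    also have "\<dots> \<le> (\<Sum>a\<in>N. \<bar>(\<integral>x. w a x \<partial>\<mu> n) - (\<integral>x. w a x \<partial>\<nu>)\<bar> * D)"
      by (rule sum_mono, rule order.trans[OF abs_ge_self]) (simp add: abs_mult gD mult_left_mono)
    also have "\<dots> = D * \<delta> n" by (simp add: \<delta>_def sum_distrib_left mult.commute)
    finally show "(\<integral>x. f x \<partial>\<mu> n) - (\<integral>x. f x \<partial>\<nu>) \<le> 2 * e + D * \<delta> n"
      using close[OF \<mu>[of n]] close[OF \<nu>] by linarith
  qed
  have "\<delta> \<longlonglongrightarrow> (\<Sum>a\<in>N. \<bar>(\<integral>x. w a x \<partial>\<nu>) - (\<integral>x. w a x \<partial>\<nu>)\<bar>)"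
    unfolding \<delta>_def[abs_def] using lim cw by (intro tendsto_intros) (auto simp: weakly_converges_def)
  then have "(\<lambda>n. 2 * e + D * \<delta> n) \<longlonglongrightarrow> 2 * e + D * 0"
    by (intro tendsto_intros) simp
  then have "\<forall>\<^sub>F n in sequentially. 2 * e + D * \<delta> n < c"
    by (rule order_tendstoD) (use c in \<open>simp add: e_def\<close>)
  then show "\<forall>\<^sub>F n in sequentially. W1 (\<mu> n) \<nu> < c"
    by eventually_elim (use bound le_less_trans in blast)
qed

section \<open>Limits of asymptotically invariant measures\<close>

lemma invariant_measures_iff_distr:
  fixes T :: "'k::metric_space \<Rightarrow> 'k"
  assumes T: "continuous_on UNIV T"
  shows "\<mu> \<in> invariant_measures T \<longleftrightarrow> \<mu> \<in> borel_probs \<and> distr \<mu> borel T = \<mu>"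
proof (cases "\<mu> \<in> borel_probs")
  case True
  note \<mu> = borel_probs_D[OF True]
  have "emeasure (distr \<mu> borel T) A = emeasure \<mu> (T -` A)" if "A \<in> sets borel" for A
    using emeasure_distr[OF measurable_borel_probs_continuous[OF True T] that] \<mu> by simp
  then show ?thesis
    using True \<mu> by (auto simp: invariant_measures_def intro!: measure_eqI)
qed (simp add: invariant_measures_def)

text \<open>
  The one limit argument behind existence, compactness and upper semicontinuity of the sets of
  invariant measures. Let \<open>\<mu> n\<close> be invariant under \<open>S n\<close> up to a vanishing error, with \<open>S n\<close> tending
  to \<open>T\<close> uniformly. For 1-Lipschitz \<open>f\<close>, replacing \<open>f \<circ> S n\<close> by \<open>f \<circ> T\<close> changes the integral by at
  most the uniform distance of the maps, so a weak limit \<open>\<nu>\<close> satisfies \<open>\<integral> f \<circ> T d\<nu> = \<integral> f d\<nu>\<close>.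
  Since 1-Lipschitz functions separate measures (\<open>W1\<close> is a metric), \<open>\<nu>\<close> is \<open>T\<close>-invariant.
\<close>

theorem asymptotically_invariant_subsequence:
  fixes T :: "'k::metric_space \<Rightarrow> 'k" and S :: "nat \<Rightarrow> 'k \<Rightarrow> 'k"
  assumes K: "compact (UNIV :: 'k set)"
    and T: "continuous_on UNIV T" and S: "\<And>n. continuous_on UNIV (S n)"
    and ST: "uniform_limit UNIV S T sequentially"
    and \<mu>: "\<And>n. \<mu> n \<in> borel_probs"
    and inv: "\<And>f :: 'k \<Rightarrow> real. continuous_on UNIV f \<Longrightarrow>
      (\<lambda>n. (\<integral>x. f (S n x) \<partial>\<mu> n) - (\<integral>x. f x \<partial>\<mu> n)) \<longlonglongrightarrow> 0"
  obtains \<nu> and r :: "nat \<Rightarrow> nat"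
  where "\<nu> \<in> invariant_measures T" "strict_mono r" "(\<lambda>n. W1 (\<mu> (r n)) \<nu>) \<longlonglongrightarrow> 0"
proof -
  obtain \<nu> and r :: "nat \<Rightarrow> nat" where \<nu>: "\<nu> \<in> borel_probs" and r: "strict_mono r"
    and lim: "weakly_converges (\<lambda>n. \<mu> (r n)) \<nu>"
    using borel_probs_weakly_sequentially_compact[OF K \<mu>] .
  have eq: "(\<integral>x. f (T x) \<partial>\<nu>) = (\<integral>x. f x \<partial>\<nu>)" if f: "1-lipschitz_on UNIV f" for f :: "'k \<Rightarrow> real"
  proof -
    have cf: "continuous_on UNIV f" by (rule lipschitz_on_continuous_on[OF f])
    have cfT: "continuous_on UNIV (\<lambda>x. f (T x))" and cfS: "continuous_on UNIV (\<lambda>x. f (S n x))" for n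
      by (rule continuous_on_compose2[OF cf]; use T S in simp)+
    have "(\<lambda>n. (\<integral>x. f (T x) \<partial>\<mu> n) - (\<integral>x. f (S n x) \<partial>\<mu> n)) \<longlonglongrightarrow> 0"
    proof (rule LIMSEQ_I)
      fix e :: real assume e: "e > 0"
      have "\<forall>\<^sub>F n in sequentially. \<forall>x\<in>UNIV. dist (S n x) (T x) < e / 2"
        using uniform_limitD[OF ST, of "e / 2"] e by simp
      then obtain n0 where n0: "\<And>n x. n \<ge> n0 \<Longrightarrow> dist (S n x) (T x) < e / 2"
        by (auto simp: eventually_sequentially)
      have "norm ((\<integral>x. f (T x) \<partial>\<mu> n) - (\<integral>x. f (S n x) \<partial>\<mu> n) - 0) < e" if n: "n \<ge> n0" for n
      proof -
        interpret prob_space "\<mu> n" using borel_probs_D[OF \<mu>] by simp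
        note int = integrable_continuous_on_compact[OF K \<mu>[of n] cfT]
          integrable_continuous_on_compact[OF K \<mu>[of n] cfS[of n]]
        have "\<bar>f (T x) - f (S n x)\<bar> \<le> e / 2" for x
          using lipschitz_onD[OF f, of "T x" "S n x"] n0[OF n, of x]
          by (simp add: dist_real_def dist_commute)
        then have "(\<integral>x. \<bar>f (T x) - f (S n x)\<bar> \<partial>\<mu> n) \<le> (\<integral>x. e / 2 \<partial>\<mu> n)"
          using int by (intro integral_mono) auto
        moreover have "\<bar>\<integral>x. f (T x) - f (S n x) \<partial>\<mu> n\<bar> \<le> (\<integral>x. \<bar>f (T x) - f (S n x)\<bar> \<partial>\<mu> n)"
          by (rule integral_abs_bound)
        ultimately show ?thesis using int e by (simp add: prob_space)
      qed
      then show "\<exists>n0. \<forall>n\<ge>n0. norm ((\<integral>x. f (T x) \<partial>\<mu> n) - (\<integral>x. f (S n x) \<partial>\<mu> n) - 0) < e" by blast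
    qed
    from LIMSEQ_subseq_LIMSEQ[OF tendsto_add[OF this inv[OF cf]] r]
    have "(\<lambda>n. (\<integral>x. f (T x) \<partial>\<mu> (r n)) - (\<integral>x. f x \<partial>\<mu> (r n))) \<longlonglongrightarrow> 0"
      by (simp add: comp_def)
    moreover have "(\<lambda>n. (\<integral>x. f (T x) \<partial>\<mu> (r n)) - (\<integral>x. f x \<partial>\<mu> (r n)))
        \<longlonglongrightarrow> (\<integral>x. f (T x) \<partial>\<nu>) - (\<integral>x. f x \<partial>\<nu>)"
      using lim cf cfT by (intro tendsto_diff) (auto simp: weakly_converges_def)
    ultimately show ?thesis using LIMSEQ_unique by fastforce
  qed
  have T\<nu>: "T \<in> borel_measurable \<nu>" by (rule measurable_borel_probs_continuous[OF \<nu> T])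
  interpret \<nu>: prob_space \<nu> using borel_probs_D[OF \<nu>] by simp
  have d: "distr \<nu> borel T \<in> borel_probs"
    using \<nu>.prob_space_distr[OF T\<nu>] by (simp add: borel_probs_def)
  have "(\<integral>x. f x \<partial>distr \<nu> borel T) = (\<integral>x. f x \<partial>\<nu>)" if "1-lipschitz_on UNIV f" for f :: "'k \<Rightarrow> real"
    using integral_distr[OF T\<nu> borel_measurable_continuous_onI[OF lipschitz_on_continuous_on[OF that]]]
      eq[OF that] by simp
  then have "W1 (distr \<nu> borel T) \<nu> \<le> 0" "W1 \<nu> (distr \<nu> borel T) \<le> 0"
    by (auto intro!: W1_least d \<nu>)
  then have "distr \<nu> borel T = \<nu>" by (rule W1_eq_0D[OF K d \<nu>])
  then have "\<nu> \<in> invariant_measures T" using \<nu> by (simp add: invariant_measures_iff_distr[OF T])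
  then show thesis
    using that r weakly_converges_imp_W1_tendsto_0[OF K \<mu> \<nu> lim] by blast
qed

lemma invariant_measures_integral:
  fixes f :: "'k::metric_space \<Rightarrow> real"
  assumes T: "continuous_on UNIV T" and \<mu>: "\<mu> \<in> invariant_measures T" and f: "continuous_on UNIV f"
  shows "(\<integral>x. f (T x) \<partial>\<mu>) = (\<integral>x. f x \<partial>\<mu>)"
proof -
  have "\<mu> \<in> borel_probs" and d: "distr \<mu> borel T = \<mu>"
    using \<mu> invariant_measures_iff_distr[OF T] by auto
  then show ?thesis
    using integral_distr[OF measurable_borel_probs_continuous[OF _ T] borel_measurable_continuous_onI[OF f], of \<mu>]
    by simp
qed

theorem invariant_measures_subsequence:
  fixes T :: "'k::metric_space \<Rightarrow> 'k" and S :: "nat \<Rightarrow> 'k \<Rightarrow> 'k"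
  assumes K: "compact (UNIV :: 'k set)"
    and T: "continuous_on UNIV T" and S: "\<And>n. continuous_on UNIV (S n)"
    and ST: "uniform_limit UNIV S T sequentially"
    and \<mu>: "\<And>n. \<mu> n \<in> invariant_measures (S n)"
  obtains \<nu> and r :: "nat \<Rightarrow> nat"
  where "\<nu> \<in> invariant_measures T" "strict_mono r" "(\<lambda>n. W1 (\<mu> (r n)) \<nu>) \<longlonglongrightarrow> 0"
proof (rule asymptotically_invariant_subsequence[OF K T S ST])
  show "\<mu> n \<in> borel_probs" for n using \<mu>[of n] by (simp add: invariant_measures_def)
  show "(\<lambda>n. (\<integral>x. f (S n x) \<partial>\<mu> n) - (\<integral>x. f x \<partial>\<mu> n)) \<longlonglongrightarrow> 0"
    if "continuous_on UNIV f" for f :: "'k \<Rightarrow> real"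
    using invariant_measures_integral[OF S \<mu> that] by simp
qed (use that in blast)

text \<open>
  The uniform distributions on longer and longer orbit segments are asymptotically invariant: by
  telescoping, moving the segment of length \<open>n + 1\<close> by one step changes an average by at most
  \<open>2 * B / (n + 1)\<close>, where \<open>B\<close> bounds the test function.
\<close>

theorem Krylov_Bogolyubov:
  fixes T :: "'k::metric_space \<Rightarrow> 'k"
  assumes K: "compact (UNIV :: 'k set)" and T: "continuous_on UNIV T"
  shows "invariant_measures T \<noteq> {}"
proof -
  define orb where "orb i = (T ^^ i) undefined" for i
  define \<mu> where "\<mu> n = distr (measure_pmf (pmf_of_set {..n})) borel orb" for n :: nat
  have \<mu>: "\<mu> n \<in> borel_probs" for n
    by (simp add: \<mu>_def borel_probs_def measure_pmf.prob_space_distr)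
  have int: "(\<integral>x. f x \<partial>\<mu> n) = (\<Sum>i\<le>n. f (orb i)) / real (Suc n)"
    if "continuous_on UNIV f" for f :: "'k \<Rightarrow> real" and n
    using borel_measurable_continuous_onI[OF that]
    by (simp add: \<mu>_def integral_distr integral_pmf_of_set)
  have almost_invariant: "(\<lambda>n. (\<integral>x. f (T x) \<partial>\<mu> n) - (\<integral>x. f x \<partial>\<mu> n)) \<longlonglongrightarrow> 0"
    if f: "continuous_on UNIV f" for f :: "'k \<Rightarrow> real"
  proof -
    obtain B where B: "\<And>x. \<bar>f x\<bar> \<le> B" using compact_continuous_bounded[OF K f] by blast
    have cfT: "continuous_on UNIV (\<lambda>x. f (T x))"
      by (rule continuous_on_compose2[OF f T]) simp
    have "(\<integral>x. f (T x) \<partial>\<mu> n) - (\<integral>x. f x \<partial>\<mu> n) = (f (orb (Suc n)) - f (orb 0)) / real (Suc n)" for n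
    proof -
      have "(\<Sum>i\<le>n. f (T (orb i))) - (\<Sum>i\<le>n. f (orb i)) = f (orb (Suc n)) - f (orb 0)"
        by (induction n) (auto simp: orb_def)
      then show ?thesis unfolding int[OF cfT] int[OF f] diff_divide_distrib[symmetric] by (rule arg_cong)
    qed
    then have "norm ((\<integral>x. f (T x) \<partial>\<mu> n) - (\<integral>x. f x \<partial>\<mu> n)) \<le> 2 * B / real (Suc n)" for n
      using B[of "orb (Suc n)"] B[of "orb 0"] by (auto simp: abs_divide intro!: divide_right_mono)
    moreover have "(\<lambda>n. (2 * B) / real (Suc n)) \<longlonglongrightarrow> 0"
      using LIMSEQ_Suc[OF lim_const_over_n[of "2 * B"]] by simp
    ultimately show ?thesis
      by (rule Lim_null_comparison[OF always_eventually[OF allI]])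
  qed
  show ?thesis
  proof (rule asymptotically_invariant_subsequence
      [where T = T and S = "\<lambda>_. T" and \<mu> = \<mu>, OF K T T uniform_limit_const \<mu>])
    show "(\<lambda>n. (\<integral>x. f (T x) \<partial>\<mu> n) - (\<integral>x. f x \<partial>\<mu> n)) \<longlonglongrightarrow> 0"
      if "continuous_on UNIV f" for f :: "'k \<Rightarrow> real"
      by (rule almost_invariant[OF that])
  qed blast
qed

section \<open>The map to the hyperspace of compact sets of measures\<close>

lemma limitin_W1_iff:
  fixes \<mu> :: "nat \<Rightarrow> 'k::metric_space measure"
  assumes K: "compact (UNIV :: 'k set)" and "\<And>n. \<mu> n \<in> borel_probs" "\<nu> \<in> borel_probs"
  shows "limitin (Metric_space.mtopology borel_probs W1) \<mu> \<nu> sequentially \<longleftrightarrow>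
    (\<lambda>n. W1 (\<mu> n) \<nu>) \<longlonglongrightarrow> 0"
  using assms by (simp add: Metric_space.limitin_metric_dist_null[OF Metric_space_W1[OF K]])

lemma invariant_measures_subset: "invariant_measures T \<subseteq> borel_probs"
  by (auto simp: invariant_measures_def)

theorem compact_space_W1:
  assumes K: "compact (UNIV :: 'k::metric_space set)"
  shows "compact_space (Metric_space.mtopology (borel_probs :: 'k measure set) W1)"
proof -
  interpret W: Metric_space "borel_probs :: 'k measure set" W1 by (rule Metric_space_W1[OF K])
  show ?thesis
    unfolding W.compact_space_sequentially
  proof (intro allI impI)
    fix \<mu> :: "nat \<Rightarrow> 'k measure" assume "range \<mu> \<subseteq> borel_probs"
    then have \<mu>: "\<And>n. \<mu> n \<in> borel_probs" by auto
    obtain \<nu> r where \<nu>: "\<nu> \<in> borel_probs" and r: "strict_mono (r :: nat \<Rightarrow> nat)"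
      and "weakly_converges (\<lambda>n. \<mu> (r n)) \<nu>"
      using borel_probs_weakly_sequentially_compact[OF K \<mu>] .
    then have "limitin W.mtopology (\<mu> \<circ> r) \<nu> sequentially"
      using weakly_converges_imp_W1_tendsto_0[OF K \<mu> \<nu>] \<mu>
      by (subst limitin_W1_iff[OF K]) (auto simp: comp_def)
    then show "\<exists>l r. l \<in> borel_probs \<and> strict_mono r \<and> limitin W.mtopology (\<mu> \<circ> r) l sequentially"
      using \<nu> r by blast
  qed
qed

lemma invariant_measures_compact:
  fixes T :: "'k::metric_space \<Rightarrow> 'k"
  assumes K: "compact (UNIV :: 'k set)" and T: "continuous_on UNIV T"
  shows "invariant_measures T \<in> Metric_space.compacts borel_probs W1"
proof -
  interpret W: Metric_space "borel_probs :: 'k measure set" W1 by (rule Metric_space_W1[OF K])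
  have "compactin W.mtopology (invariant_measures T)"
    unfolding W.compactin_sequentially
  proof (intro conjI allI impI invariant_measures_subset)
    fix \<mu> :: "nat \<Rightarrow> 'k measure" assume "range \<mu> \<subseteq> invariant_measures T"
    then have \<mu>: "\<And>n. \<mu> n \<in> invariant_measures T" by auto
    obtain \<nu> r where \<nu>: "\<nu> \<in> invariant_measures T"
      and r: "strict_mono (r :: nat \<Rightarrow> nat)" and "(\<lambda>n. W1 (\<mu> (r n)) \<nu>) \<longlonglongrightarrow> 0"
      using invariant_measures_subsequence[OF K T T uniform_limit_const \<mu>] .
    then have "limitin W.mtopology (\<mu> \<circ> r) \<nu> sequentially"
      using \<mu> invariant_measures_subset by (subst limitin_W1_iff[OF K]) (auto simp: comp_def)
    then show "\<exists>l r. l \<in> invariant_measures T \<and> strict_mono r \<and>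
        limitin W.mtopology (\<mu> \<circ> r) l sequentially"
      using \<nu> r by blast
  qed
  then show ?thesis using Krylov_Bogolyubov[OF K T] by (simp add: W.compacts_def)
qed

lemma continuous_on_apply_bcontfun: "continuous_on UNIV (apply_bcontfun S)"
  using apply_bcontfun[of S] by (simp add: bcontfun_def)

text \<open>
  This is upper semicontinuity of the set of invariant measures: a measure in \<open>C\<close> that is
  invariant under \<open>S n\<close>, chosen for each \<open>n\<close>, subconverges to one that is invariant under the limit map.
\<close>

lemma closed_invariant_measures_meet:
  assumes K: "compact (UNIV :: 'k::metric_space set)"
    and C: "closedin (Metric_space.mtopology borel_probs W1) C"
  shows "closed {S :: 'k \<Rightarrow>\<^sub>C 'k. invariant_measures (apply_bcontfun S) \<inter> C \<noteq> {}}"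
  unfolding closed_sequential_limits
proof (intro allI impI, elim conjE)
  interpret W: Metric_space "borel_probs :: 'k measure set" W1 by (rule Metric_space_W1[OF K])
  fix S and T :: "'k \<Rightarrow>\<^sub>C 'k"
  assume "\<forall>n. S n \<in> {S. invariant_measures (apply_bcontfun S) \<inter> C \<noteq> {}}" and ST: "S \<longlonglongrightarrow> T"
  then obtain \<mu> where \<mu>: "\<And>n. \<mu> n \<in> invariant_measures (apply_bcontfun (S n))"
    and \<mu>C: "\<And>n. \<mu> n \<in> C"
    by (simp add: ex_in_conv[symmetric]) metis
  obtain \<nu> r where \<nu>: "\<nu> \<in> invariant_measures (apply_bcontfun T)"
    and "strict_mono (r :: nat \<Rightarrow> nat)" and "(\<lambda>n. W1 (\<mu> (r n)) \<nu>) \<longlonglongrightarrow> 0"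
    using invariant_measures_subsequence[OF K continuous_on_apply_bcontfun
        continuous_on_apply_bcontfun tendsto_bcontfun_uniform_limit[OF ST] \<mu>] .
  then have "limitin W.mtopology (\<lambda>n. \<mu> (r n)) \<nu> sequentially"
    using \<mu> invariant_measures_subset by (subst limitin_W1_iff[OF K]) auto
  then have "\<nu> \<in> C"
    by (rule limitin_closedin[OF _ C]) (simp_all add: \<mu>C)
  with \<nu> show "T \<in> {S. invariant_measures (apply_bcontfun S) \<inter> C \<noteq> {}}" by blast
qed

theorem theorem2p2:
  assumes "compact (UNIV :: 'k::metric_space set)"
  shows "\<exists>Y :: ('k \<Rightarrow>\<^sub>C 'k) set. residual Y \<and>
    (\<forall>T\<in>Y. topcontinuous_at euclidean
              (Metric_space.mtopology (compact_measure_sets :: 'k measure set set) hausdorff_W1)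
              (\<lambda>S. invariant_measures (apply_bcontfun S)) T)"
  unfolding compact_measure_sets_def hausdorff_W1_def
  by (intro Metric_space.residual_continuity_points Metric_space_W1 compact_space_W1
      invariant_measures_compact closed_invariant_measures_meet continuous_on_apply_bcontfun assms)

end
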